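(* For all formulas $q_1,\dots,q_n,q\in F(V)$: if $q_1,\dots,q_n\vdash_{\mathrm{sq}\L^*}q$, then $q_1,\dots,q_n\vDash_{\mathbb{SQW^*}}q$.
   Context: Let $V$ be a set of propositional variables and $F(V)$ the set of formulas built from $V$ and the constant $1$ using $\to$ and $\neg$. Abbreviations: $p^+:=(p\to 1)\to 1$, $p^-:=(p\to\neg 1)\to\neg 1$ (binding more tightly than $\neg$), $p\vee q:=((p^+\to q^+)^+\to(\neg p)^-)\to((q^-\to p^-)^-\to p^-)$; an axiom "$p\leftrightarrow q$" stands for the two axioms $p\to q$ and $q\to p$. The logic $\mathrm{sq}\L^*$ has axiom schemas (for all $p,q,r\in F(V)$): (Q1) $(p\to q)\leftrightarrow(\neg q\to\neg p)$; (Q2) $1\leftrightarrow((1\to p)\to 1)$; (Q3) $p\leftrightarrow((q\to q)\to p)$; (Q4) $(p\to q)\leftrightarrow((q^+\to p^-)\to(p^+\to q^-))$; (Q5) $\neg(p\to q)\leftrightarrow(q\to p)$; (Q6) $(p\to(\neg p\to q))^+\leftrightarrow(p^+\to(\neg p^+\to q^+))$; (Q7) $(p\to(q\vee r))\leftrightarrow((p\to r)\vee(p\to q))$; (Q8) $(p\vee(q\vee r))\leftrightarrow((p\vee q)\vee r)$; (Q9) $((p\to 1)\to((q\to 1)\to r))\to((q\to 1)\to((p\to 1)\to r))$; (Q10) $p\to 1$; and rules: (qMP) from $(r\to r)\to p$ and $(r\to r)\to(p\to q)$ infer $(r\to r)\to q$; (Reg) from $p$ infer $(r\to r)\to p$;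 (AReg1) from $(r\to r)\to(p\to q)$ infer $p\to q$; (AReg2) from $(r\to r)\to\neg(p\to q)$ infer $\neg(p\to q)$; (AReg3) from $(r\to r)\to\neg 1$ infer $\neg 1$; (AReg4) from $(r\to r)\to 1$ infer $1$; (Inv1) from $p$ infer $\neg\neg p$; (Inv2) from $\neg\neg p$ infer $p$; (Flat) from $p$ and $\neg 1$ infer $\neg p$; (R2$'$) from $p\to q$ and $r\to t$ infer $(q\to r)\to(p\to t)$; (R3$'$) from $(r\to r)\to p$ infer $p^-$. $q_1,\dots,q_n\vdash_{\mathrm{sq}\L^*}q$ means there is a finite sequence ending with $q$ whose members are axiom instances, among $q_1,\dots,q_n$, or follow from earlier members by rules. Semantics: a quasi-Wajsberg* algebra is an algebra $\langle W;\to,\neg,{}^+,{}^-,1\rangle$ of type $\langle 2,1,1,1,0\rangle$ such that for all $x,y,z$: $x\to y=\neg y\to\neg x$; $(x\to 1)\to((y\to 1)\to z)=(y\to 1)\to((x\to 1)\to z)$; $(1\to x)\to 1=1$; $(z\to z)\to(x\to y)=x\to y$; $(1\to 1)\to x^{+}=((1\to 1)\to x)^{+}=(x\to 1)\to 1$ and $(1\to 1)\to x^{-}=((1\to 1)\to x)^{-}=(x\to\neg 1)\to\neg 1$; $x\to y=(y^{+}\to x^{-})\to(x^{+}\to y^{-})$; $\neg(x\to y)=y\to x$; $\neg\neg x=x$; $(x\to(\neg x\to y))^{+}=x^{+}\to(\neg x^{+}\to y^{+})$; $x\vee y=y\vee x$; $x\vee(y\vee z)=(x\vee y)\vee z$;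 $x\to(y\vee z)=(x\to y)\vee(x\to z)$, with $x\vee y:=((x^{+}\to y^{+})^{+}\to(\neg x)^{-})\to((y^{-}\to x^{-})^{-}\to x^{-})$. A strong quasi-Wajsberg* algebra additionally satisfies $x^+=(1\to 1)\to x^+$ and $x^-=(1\to 1)\to x^-$; $\mathbb{SQW^*}$ is the class of these. An element $d$ of such an algebra $\mathbf{A}$ is designated if $d=(c\to 1)\to 1$ for some $c\in A$. $q_1,\dots,q_n\vDash_{\mathbb{SQW^*}}q$ means: for every $\mathbf{A}\in\mathbb{SQW^*}$ and every assignment of the variables in $A$, if the values of $q_1,\dots,q_n$ are all designated then the value of $q$ is designated. *)

theory Defs
  imports Main
begin

datatype 'v fm = Var 'v | One | Imp "'v fm" "'v fm" | Neg "'v fm"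

definition fplus :: "'v fm \<Rightarrow> 'v fm" where
  "fplus p = Imp (Imp p One) One"

definition fminus :: "'v fm \<Rightarrow> 'v fm" where
  "fminus p = Imp (Imp p (Neg One)) (Neg One)"

definition fjoin :: "'v fm \<Rightarrow> 'v fm \<Rightarrow> 'v fm" where
  "fjoin p q = Imp (Imp (fplus (Imp (fplus p) (fplus q))) (fminus (Neg p)))
                   (Imp (fminus (Imp (fminus q) (fminus p))) (fminus p))"

inductive axiom :: "'v fm \<Rightarrow> bool" where
  Q1a: "axiom (Imp (Imp p q) (Imp (Neg q) (Neg p)))"
| Q1b: "axiom (Imp (Imp (Neg q) (Neg p)) (Imp p q))"
| Q2a: "axiom (Imp One (Imp (Imp One p) One))"
| Q2b: "axiom (Imp (Imp (Imp One p) One) One)"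
| Q3a: "axiom (Imp p (Imp (Imp q q) p))"
| Q3b: "axiom (Imp (Imp (Imp q q) p) p)"
| Q4a: "axiom (Imp (Imp p q) (Imp (Imp (fplus q) (fminus p)) (Imp (fplus p) (fminus q))))"
| Q4b: "axiom (Imp (Imp (Imp (fplus q) (fminus p)) (Imp (fplus p) (fminus q))) (Imp p q))"
| Q5a: "axiom (Imp (Neg (Imp p q)) (Imp q p))"
| Q5b: "axiom (Imp (Imp q p) (Neg (Imp p q)))"
| Q6a: "axiom (Imp (fplus (Imp p (Imp (Neg p) q))) (Imp (fplus p) (Imp (Neg (fplus p)) (fplus q))))"
| Q6b: "axiom (Imp (Imp (fplus p) (Imp (Neg (fplus p)) (fplus q))) (fplus (Imp p (Imp (Neg p) q))))"
| Q7a: "axiom (Imp (Imp p (fjoin q r)) (fjoin (Imp p r) (Imp p q)))"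
| Q7b: "axiom (Imp (fjoin (Imp p r) (Imp p q)) (Imp p (fjoin q r)))"
| Q8a: "axiom (Imp (fjoin p (fjoin q r)) (fjoin (fjoin p q) r))"
| Q8b: "axiom (Imp (fjoin (fjoin p q) r) (fjoin p (fjoin q r)))"
| Q9: "axiom (Imp (Imp (Imp p One) (Imp (Imp q One) r)) (Imp (Imp q One) (Imp (Imp p One) r)))"
| Q10: "axiom (Imp p One)"

inductive deriv :: "'v fm list \<Rightarrow> 'v fm \<Rightarrow> bool" for H :: "'v fm list" where
  ax: "axiom p \<Longrightarrow> deriv H p"
| hyp: "p \<in> set H \<Longrightarrow> deriv H p"
| qMP: "deriv H (Imp (Imp r r) p) \<Longrightarrow> deriv H (Imp (Imp r r) (Imp p q)) \<Longrightarrow> deriv H (Imp (Imp r r) q)"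
| Reg: "deriv H p \<Longrightarrow> deriv H (Imp (Imp r r) p)"
| AReg1: "deriv H (Imp (Imp r r) (Imp p q)) \<Longrightarrow> deriv H (Imp p q)"
| AReg2: "deriv H (Imp (Imp r r) (Neg (Imp p q))) \<Longrightarrow> deriv H (Neg (Imp p q))"
| AReg3: "deriv H (Imp (Imp r r) (Neg One)) \<Longrightarrow> deriv H (Neg One)"
| AReg4: "deriv H (Imp (Imp r r) One) \<Longrightarrow> deriv H One"
| Inv1: "deriv H p \<Longrightarrow> deriv H (Neg (Neg p))"
| Inv2: "deriv H (Neg (Neg p)) \<Longrightarrow> deriv H p"
| Flat: "deriv H p \<Longrightarrow> deriv H (Neg One) \<Longrightarrow> deriv H (Neg p)"
| R2': "deriv H (Imp p q) \<Longrightarrow> deriv H (Imp r t) \<Longrightarrow> deriv H (Imp (Imp q r) (Imp p t))"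
| R3': "deriv H (Imp (Imp r r) p) \<Longrightarrow> deriv H (fminus p)"

definition ajoin :: "('a \<Rightarrow> 'a \<Rightarrow> 'a) \<Rightarrow> ('a \<Rightarrow> 'a) \<Rightarrow> ('a \<Rightarrow> 'a) \<Rightarrow> ('a \<Rightarrow> 'a) \<Rightarrow> 'a \<Rightarrow> 'a \<Rightarrow> 'a" where
  "ajoin imp neg pl mi x y =
     imp (imp (pl (imp (pl x) (pl y))) (mi (neg x))) (imp (mi (imp (mi y) (mi x))) (mi x))"

definition qW_star :: "('a \<Rightarrow> 'a \<Rightarrow> 'a) \<Rightarrow> ('a \<Rightarrow> 'a) \<Rightarrow> ('a \<Rightarrow> 'a) \<Rightarrow> ('a \<Rightarrow> 'a) \<Rightarrow> 'a \<Rightarrow> bool" where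
  "qW_star imp neg pl mi one \<longleftrightarrow>
    (\<forall>x y z.
      imp x y = imp (neg y) (neg x) \<and>
      imp (imp x one) (imp (imp y one) z) = imp (imp y one) (imp (imp x one) z) \<and>
      imp (imp one x) one = one \<and>
      imp (imp z z) (imp x y) = imp x y \<and>
      imp (imp one one) (pl x) = pl (imp (imp one one) x) \<and>
      pl (imp (imp one one) x) = imp (imp x one) one \<and>
      imp (imp one one) (mi x) = mi (imp (imp one one) x) \<and>
      mi (imp (imp one one) x) = imp (imp x (neg one)) (neg one) \<and>
      imp x y = imp (imp (pl y) (mi x)) (imp (pl x) (mi y)) \<and>
      neg (imp x y) = imp y x \<and>
      neg (neg x) = x \<and>
      pl (imp x (imp (neg x) y)) = imp (pl x) (imp (neg (pl x)) (pl y)) \<and>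
      ajoin imp neg pl mi x y = ajoin imp neg pl mi y x \<and>
      ajoin imp neg pl mi x (ajoin imp neg pl mi y z) = ajoin imp neg pl mi (ajoin imp neg pl mi x y) z \<and>
      imp x (ajoin imp neg pl mi y z) = ajoin imp neg pl mi (imp x y) (imp x z))"

definition sqW_star :: "('a \<Rightarrow> 'a \<Rightarrow> 'a) \<Rightarrow> ('a \<Rightarrow> 'a) \<Rightarrow> ('a \<Rightarrow> 'a) \<Rightarrow> ('a \<Rightarrow> 'a) \<Rightarrow> 'a \<Rightarrow> bool" where
  "sqW_star imp neg pl mi one \<longleftrightarrow> qW_star imp neg pl mi one \<and>
    (\<forall>x. pl x = imp (imp one one) (pl x) \<and> mi x = imp (imp one one) (mi x))"

definition designated :: "('a \<Rightarrow> 'a \<Rightarrow> 'a) \<Rightarrow> 'a \<Rightarrow> 'a \<Rightarrow> bool" where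
  "designated imp one d \<longleftrightarrow> (\<exists>c. d = imp (imp c one) one)"

primrec eval :: "('a \<Rightarrow> 'a \<Rightarrow> 'a) \<Rightarrow> ('a \<Rightarrow> 'a) \<Rightarrow> 'a \<Rightarrow> ('v \<Rightarrow> 'a) \<Rightarrow> 'v fm \<Rightarrow> 'a" where
  "eval imp neg one e (Var x) = e x"
| "eval imp neg one e One = one"
| "eval imp neg one e (Imp p q) = imp (eval imp neg one e p) (eval imp neg one e q)"
| "eval imp neg one e (Neg p) = neg (eval imp neg one e p)"

text \<open>Semantic consequence w.r.t. all strong quasi-Wajsberg* algebras on the type 'a;
  the theorem quantifies over all types 'a (type variables are schematic).\<close>

definition sem_conseq :: "'a itself \<Rightarrow> 'v fm list \<Rightarrow> 'v fm \<Rightarrow> bool" where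
  "sem_conseq _ H q \<longleftrightarrow>
    (\<forall>(imp::'a \<Rightarrow> 'a \<Rightarrow> 'a) neg pl mi one (e::'v \<Rightarrow> 'a).
       sqW_star imp neg pl mi one \<longrightarrow>
       (\<forall>p\<in>set H. designated imp one (eval imp neg one e p)) \<longrightarrow>
       designated imp one (eval imp neg one e q))"

end

theory Submission
  imports Defs
begin

text \<open>
  Write \<open>x + y\<close> for \<open>\<not>x \<rightarrow> y\<close> and 0 for \<open>1 \<rightarrow> 1\<close>; in the standard model this is addition truncated to
  the interval from -1 to 1, and designated means nonnegative.  The whole theorem rests on the equivalence of
  "\<open>x \<rightarrow> y\<close> is designated" with \<open>x \<squnion> y = 0 + y\<close>: it turns every axiom into an inequality, and the
  rules qMP and R2' into transitivity and monotonicity.  The easy half is that addition distributes over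
  joins.  For the other half, split \<open>x = x\<^sup>+ - (-x)\<^sup>+\<close>, so that \<open>y - x \<ge> 0\<close> becomes
  \<open>x\<^sup>+ + (-y)\<^sup>+ \<le> (-x)\<^sup>+ + y\<^sup>+\<close> between nonnegative elements.  There addition is associative, so
  the disjointness of \<open>x\<^sup>+\<close> and \<open>(-x)\<^sup>+\<close> yields \<open>x\<^sup>+ \<le> y\<^sup>+\<close> and likewise
  \<open>(-y)\<^sup>+ \<le> (-x)\<^sup>+\<close>, and the join formula then computes \<open>x \<squnion> y\<close>.
\<close>

section \<open>The algebra in additive notation\<close>

locale sqW_star_algebra =
  fixes imp :: "'a \<Rightarrow> 'a \<Rightarrow> 'a" and neg pl mi :: "'a \<Rightarrow> 'a" and one :: 'a
  assumes sqW_star: "sqW_star imp neg pl mi one"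
begin

definition add :: "'a \<Rightarrow> 'a \<Rightarrow> 'a" (infixl "\<oplus>" 65) where
  "x \<oplus> y = imp (neg x) y"

definition zero :: 'a where
  "zero = imp one one"

abbreviation join :: "'a \<Rightarrow> 'a \<Rightarrow> 'a" where
  "join \<equiv> ajoin imp neg pl mi"

lemma
  contrapos: "imp x y = imp (neg y) (neg x)" and
  one_exchange: "imp (imp x one) (imp (imp y one) z) = imp (imp y one) (imp (imp x one) z)" and
  imp_one_absorb: "imp (imp one x) one = one" and
  self_imp_unit: "imp (imp z z) (imp x y) = imp x y" and
  imp_decomp: "imp x y = imp (imp (pl y) (mi x)) (imp (pl x) (mi y))" and
  neg_imp: "neg (imp x y) = imp y x" and
  neg_neg [simp]: "neg (neg x) = x" and
  pl_imp: "pl (imp x (imp (neg x) y)) = imp (pl x) (imp (neg (pl x)) (pl y))" and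
  join_commute: "join x y = join y x" and
  join_assoc: "join x (join y z) = join (join x y) z" and
  imp_join: "imp x (join y z) = join (imp x y) (imp x z)"
  using sqW_star unfolding sqW_star_def qW_star_def by blast+

lemma pl_eq_imp: "pl x = imp (imp x one) one"
  and mi_eq_imp: "mi x = imp (imp x (neg one)) (neg one)"
  using sqW_star unfolding sqW_star_def qW_star_def by metis+

text \<open>Each of \<open>imp x x\<close> and \<open>imp one one\<close> acts as a unit on the
  other, and each is its own negation, so contraposition equates the two products.\<close>

lemma imp_self: "imp x x = zero"
  unfolding zero_def using self_imp_unit[of x one one] self_imp_unit[of one x x] contrapos neg_imp
  by metis

lemma imp_eq_add: "imp x y = neg x \<oplus> y"
  by (simp add: add_def)

lemma add_commute: "x \<oplus> y = y \<oplus> x"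
  by (metis add_def contrapos neg_neg)

lemma neg_add: "neg (x \<oplus> y) = neg x \<oplus> neg y"
  by (metis add_def contrapos neg_imp)

lemma add_neg: "x \<oplus> neg x = zero"
  by (metis add_def add_commute neg_neg imp_self)

lemma neg_zero [simp]: "neg zero = zero"
  by (metis imp_self neg_imp)

lemma add_add_zero [simp]: "(x \<oplus> y) \<oplus> zero = x \<oplus> y"
  by (metis add_def add_commute neg_zero self_imp_unit zero_def)

lemma pl_eq: "pl x = one \<oplus> (neg one \<oplus> x)"
  by (metis add_commute imp_eq_add neg_add neg_neg pl_eq_imp)

lemma mi_eq: "mi x = neg one \<oplus> (one \<oplus> x)"
  by (metis add_commute imp_eq_add neg_add neg_neg mi_eq_imp)

lemma one_one_absorb: "one \<oplus> (one \<oplus> x) = one"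
  by (metis add_commute imp_eq_add neg_add neg_neg imp_one_absorb)

lemma neg_one_add_exchange:
  "(neg one \<oplus> x) \<oplus> ((neg one \<oplus> y) \<oplus> z) = (neg one \<oplus> y) \<oplus> ((neg one \<oplus> x) \<oplus> z)"
  using one_exchange[of x y z] by (simp add: imp_eq_add neg_add add_commute[of _ "neg one"])

lemma one_add_exchange: "(one \<oplus> x) \<oplus> ((one \<oplus> y) \<oplus> z) = (one \<oplus> y) \<oplus> ((one \<oplus> x) \<oplus> z)"
  using arg_cong[where f=neg, OF neg_one_add_exchange[of "neg x" "neg y" "neg z"]]
  by (simp add: neg_add)

lemma neg_pl: "neg (pl x) = mi (neg x)"
  by (simp add: pl_eq mi_eq neg_add)

lemma neg_mi: "neg (mi x) = pl (neg x)"
  by (simp add: pl_eq mi_eq neg_add)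

lemma add_decomp: "x \<oplus> y = (pl x \<oplus> pl y) \<oplus> (mi x \<oplus> mi y)"
  using imp_decomp[of "neg x" y]
  by (simp add: imp_eq_add neg_add neg_mi flip: neg_mi)
    (simp add: neg_mi neg_pl add_commute)

lemma pl_zero_add: "pl (zero \<oplus> x) = pl x" and mi_zero_add: "mi (zero \<oplus> x) = mi x"
  using sqW_star pl_eq_imp mi_eq_imp unfolding sqW_star_def qW_star_def add_def neg_zero unfolding zero_def
  by metis+

text \<open>By \<open>add_decomp\<close> a sum depends only on the positive and negative parts of
  its summands, and these do not see an added 0.\<close>

lemma zero_add_add: "(zero \<oplus> x) \<oplus> y = x \<oplus> y"
  by (metis add_decomp pl_zero_add mi_zero_add)

lemma pl_cancel: "pl (neg x \<oplus> (x \<oplus> y)) = neg (pl x) \<oplus> (pl x \<oplus> pl y)"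
  using pl_imp[of x y] by (simp add: imp_eq_add)

text \<open>Both summands are maxima written as \<open>a + (b - a)\<^sup>+\<close>: the first of the
  positive parts, the second of the negative parts.\<close>

lemma join_eq: "join x y = (pl x \<oplus> pl (neg (pl x) \<oplus> pl y)) \<oplus> (mi x \<oplus> pl (neg (mi x) \<oplus> mi y))"
  by (simp add: ajoin_def imp_eq_add neg_add neg_mi neg_pl) (simp add: add_commute neg_mi neg_pl)

lemma add_join: "x \<oplus> join y z = join (x \<oplus> y) (x \<oplus> z)"
  by (simp add: add_def imp_join)

section \<open>Arithmetic of 0, 1, positive and negative parts\<close>

lemma zero_add_one: "zero \<oplus> one = one"
  by (metis add_add_zero add_commute one_one_absorb)

lemma zero_add_regular [simp]: "zero \<oplus> (x \<oplus> y) = x \<oplus> y"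
  by (metis add_add_zero add_commute)

lemma zero_add_pl [simp]: "zero \<oplus> pl x = pl x"
  by (simp add: pl_eq)

lemma zero_add_mi [simp]: "zero \<oplus> mi x = mi x"
  by (simp add: mi_eq)

lemma pl_add_zero [simp]: "pl x \<oplus> zero = pl x"
  by (simp add: pl_eq)

lemma mi_add_zero [simp]: "mi x \<oplus> zero = mi x"
  by (simp add: mi_eq)

lemma zero_add_zero [simp]: "zero \<oplus> zero = zero"
  by (metis add_neg neg_zero)

lemma pl_one [simp]: "pl one = one"
  by (metis add_commute add_neg zero_add_one pl_eq)

lemma mi_one [simp]: "mi one = zero"
  by (metis add_commute add_neg mi_eq zero_add_one one_one_absorb)

text \<open>In the decomposition of \<open>one \<oplus> x\<close> the 1 absorbs \<open>pl x\<close>;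
  unfolding \<open>mi\<close> in what is left produces the formula for \<open>pl\<close>.\<close>

lemma pl_one_add [simp]: "pl (one \<oplus> x) = one \<oplus> x"
proof -
  have "one \<oplus> x = (one \<oplus> pl x) \<oplus> mi x"
    using add_decomp[of one x] by simp
  also have "one \<oplus> pl x = one"
    by (simp add: pl_eq one_one_absorb)
  finally show ?thesis
    unfolding pl_eq mi_eq by (rule sym)
qed

lemma pl_pl [simp]: "pl (pl x) = pl x"
  using pl_one_add[of "neg one \<oplus> x"] by (simp flip: pl_eq)

lemma pl_zero [simp]: "pl zero = zero"
  by (simp add: imp_one_absorb pl_eq_imp zero_def)

lemma mi_zero [simp]: "mi zero = zero"
  by (metis neg_mi neg_neg neg_zero pl_zero)

lemma mi_pl [simp]: "mi (pl x) = zero"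
  by (simp add: mi_eq pl_eq one_one_absorb) (metis add_commute add_neg)

lemma pl_mi [simp]: "pl (mi x) = zero"
  by (metis neg_mi neg_pl neg_neg neg_zero mi_pl)

lemma pl_add_mi: "pl x \<oplus> mi x = zero \<oplus> x"
  using add_decomp[of x zero] by (metis add_commute mi_zero pl_zero zero_add_mi zero_add_pl)

lemma join_zero: "join zero x = pl x"
  by (simp add: join_eq)

section \<open>Nonnegative elements and associativity\<close>

definition nonneg :: "'a \<Rightarrow> bool" where
  "nonneg x \<longleftrightarrow> pl x = x"

text \<open>
  A quasi-algebra has elements with \<open>0 + x \<noteq> x\<close>.  The summand 0 on the right makes the relation a
  preorder that ignores the difference between \<open>x\<close> and \<open>0 + x\<close>.
\<close>

definition leq :: "'a \<Rightarrow> 'a \<Rightarrow> bool" (infix "\<sqsubseteq>" 50) where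
  "x \<sqsubseteq> y \<longleftrightarrow> join x y = zero \<oplus> y"

lemma nonneg_pl [simp]: "nonneg (pl x)"
  by (simp add: nonneg_def)

lemma nonneg_zero [simp]: "nonneg zero"
  by (simp add: nonneg_def)

lemma nonneg_one_add: "nonneg (one \<oplus> x)"
  by (simp add: nonneg_def)

lemma zero_add_nonneg: "nonneg x \<Longrightarrow> zero \<oplus> x = x"
  by (metis nonneg_def zero_add_pl)

lemma nonneg_add_zero: "nonneg x \<Longrightarrow> x \<oplus> zero = x"
  by (metis nonneg_def pl_add_zero)

lemma mi_nonneg: "nonneg x \<Longrightarrow> mi x = zero"
  by (metis nonneg_def mi_pl)

lemma pl_neg_nonneg: "nonneg x \<Longrightarrow> pl (neg x) = zero"
  by (metis mi_nonneg neg_mi neg_zero)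

text \<open>Nonnegative elements have the form \<open>one \<oplus> t\<close>, to which
  \<open>one_add_exchange\<close> applies. This yields associativity on them; truncated addition in
  general is not associative.\<close>

lemma nonneg_exchange:
  assumes "nonneg u" "nonneg v"
  shows "u \<oplus> (v \<oplus> w) = v \<oplus> (u \<oplus> w)"
  using assms one_add_exchange unfolding nonneg_def pl_eq by metis

lemma nonpos_exchange:
  assumes "nonneg u" "nonneg v"
  shows "neg u \<oplus> (neg v \<oplus> w) = neg v \<oplus> (neg u \<oplus> w)"
  using nonneg_exchange[OF assms, of "neg w"] by (metis neg_add neg_neg)

lemma nonneg_add:
  assumes "nonneg u" "nonneg v"
  shows "nonneg (u \<oplus> v)"
proof -
  have "u \<oplus> v = u \<oplus> (one \<oplus> (neg one \<oplus> v))"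
    using assms by (simp add: nonneg_def flip: pl_eq)
  also have "\<dots> = one \<oplus> (u \<oplus> (neg one \<oplus> v))"
    using assms nonneg_exchange by (simp add: nonneg_def)
  finally show ?thesis
    by (simp add: nonneg_one_add)
qed

lemma nonneg_add_assoc:
  assumes "nonneg u" "nonneg v" "nonneg w"
  shows "(u \<oplus> v) \<oplus> w = u \<oplus> (v \<oplus> w)"
  using assms by (metis nonneg_exchange add_commute)

text \<open>
  On nonnegative elements this is the identity \<open>a \<ominus> b = (a' \<oplus> b)'\<close> of MV-algebras, with \<open>a' = 1 - a\<close>.
\<close>

lemma pl_diff:
  assumes "nonneg b"
  shows "pl (neg b \<oplus> a) = one \<oplus> neg (b \<oplus> (one \<oplus> neg a))"
  using nonpos_exchange[of b one a] assms
  by (simp add: nonneg_def neg_add) (simp add: pl_eq)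

lemma pl_cancel_nonneg:
  assumes "nonneg v"
  shows "pl (v \<oplus> (neg v \<oplus> w)) = pl w"
  using pl_cancel[of "neg v" w] assms by (simp add: pl_neg_nonneg)

lemma mi_cancel: "mi (neg x \<oplus> (x \<oplus> y)) = neg (mi x) \<oplus> (mi x \<oplus> mi y)"
  using arg_cong[where f = neg, OF pl_cancel[of "neg x" "neg y"]]
  by (simp add: neg_pl neg_add neg_mi)

section \<open>The preorder and nonnegative differences\<close>

lemma join_nonneg:
  assumes "nonneg u" "nonneg v"
  shows "join v u = v \<oplus> pl (neg v \<oplus> u)"
  using assms by (simp add: join_eq mi_nonneg) (simp add: nonneg_def)

lemma join_zero_add_left: "join (zero \<oplus> x) y = join x y"
  by (simp add: join_eq pl_zero_add mi_zero_add)

lemma join_zero_add_right: "join x (zero \<oplus> y) = join x y"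
  by (simp add: join_eq pl_zero_add mi_zero_add)

lemma leq_trans [trans]: "x \<sqsubseteq> y \<Longrightarrow> y \<sqsubseteq> z \<Longrightarrow> x \<sqsubseteq> z"
  unfolding leq_def by (metis join_assoc join_zero_add_left join_zero_add_right)

lemma le_add_left: "y \<sqsubseteq> z \<Longrightarrow> x \<oplus> y \<sqsubseteq> x \<oplus> z"
  unfolding leq_def by (metis add_commute add_join zero_add_add zero_add_regular)

text \<open>The positive part is the join with 0, so this is a regrouping of joins.\<close>

lemma le_pl:
  assumes "x \<sqsubseteq> y"
  shows "pl x \<sqsubseteq> pl y"
proof -
  have "join (pl x) (pl y) = join (join zero zero) (join x y)"
    by (metis join_zero join_assoc join_commute)
  also have "\<dots> = pl y"
    using assms by (simp add: leq_def join_zero pl_zero_add)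
  finally show ?thesis by (simp add: leq_def)
qed

lemma zero_le_iff: "zero \<sqsubseteq> x \<longleftrightarrow> pl x = zero \<oplus> x"
  by (simp add: leq_def join_zero)

lemma zero_le_nonneg: "nonneg x \<Longrightarrow> zero \<sqsubseteq> x"
  by (simp add: zero_le_iff zero_add_nonneg) (simp add: nonneg_def)

text \<open>Adding \<open>neg x\<close> to both sides puts 0 below the difference, which, being a
  sum, absorbs 0 and thus equals its positive part.\<close>

lemma nonneg_diff_of_le: "x \<sqsubseteq> y \<Longrightarrow> nonneg (neg x \<oplus> y)"
  using le_add_left[of x y "neg x"] add_neg[of "neg x"]
  by (simp add: zero_le_iff nonneg_def)

lemma le_of_nonneg_diff_nonneg:
  assumes "nonneg u" "nonneg v" "nonneg (neg v \<oplus> u)"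
  shows "v \<sqsubseteq> u"
proof -
  have "join v u = v \<oplus> (neg v \<oplus> u)"
    using assms by (simp add: join_nonneg) (simp add: nonneg_def)
  also have "\<dots> = pl (v \<oplus> (neg v \<oplus> u))"
    using nonneg_add assms by (simp add: nonneg_def)
  also have "\<dots> = u"
    using assms by (simp add: pl_cancel_nonneg) (simp add: nonneg_def)
  finally show ?thesis
    using assms by (simp add: leq_def zero_add_nonneg)
qed

lemma pl_cancel_le:
  assumes v: "nonneg v" and w: "nonneg w"
  shows "pl (neg v \<oplus> (v \<oplus> w)) \<sqsubseteq> w"
proof -
  define s where "s = v \<oplus> w"
  have s: "nonneg s"
    using v w by (simp add: s_def nonneg_add)
  have c: "nonneg (one \<oplus> neg s)"
    by (rule nonneg_one_add)
  \<comment> \<open>Two uses of \<open>pl_diff\<close> turn the iterated difference into the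
    complement of \<open>w + (v + (1 - s))\<close>. Associativity makes that sum
    \<open>s + (1 - s) = 1\<close>.\<close>
  have "pl (neg w \<oplus> pl (neg v \<oplus> s)) = one \<oplus> neg (w \<oplus> pl (v \<oplus> (one \<oplus> neg s)))"
    using v w by (simp add: pl_diff) (simp add: pl_eq neg_add)
  also have "pl (v \<oplus> (one \<oplus> neg s)) = v \<oplus> (one \<oplus> neg s)"
    using nonneg_add[OF v c] by (simp add: nonneg_def)
  also have "w \<oplus> (v \<oplus> (one \<oplus> neg s)) = s \<oplus> (one \<oplus> neg s)"
    unfolding s_def[symmetric] using nonneg_add_assoc[OF w v c] by (metis s_def add_commute)
  also have "\<dots> = one \<oplus> (s \<oplus> neg s)"
    using s by (intro nonneg_exchange) (simp_all add: nonneg_def)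
  also have "\<dots> = one"
    by (metis add_neg add_commute zero_add_one)
  finally have "pl (neg w \<oplus> pl (neg v \<oplus> s)) = zero"
    by (simp add: add_neg)
  then have "join w (pl (neg v \<oplus> s)) = w"
    using w by (simp add: join_nonneg) (metis zero_add_nonneg add_commute)
  then show ?thesis
    using w unfolding s_def[symmetric] by (simp add: leq_def zero_add_nonneg join_commute)
qed

text \<open>Here \<open>(u - v)\<^sup>+ = u\<close> says that \<open>u\<close> and \<open>v\<close> are disjoint.\<close>

lemma le_of_disjoint:
  assumes "nonneg v" "nonneg w" "u \<sqsubseteq> v \<oplus> w" "pl (neg v \<oplus> u) = u"
  shows "u \<sqsubseteq> w"
  using le_pl[OF le_add_left[OF assms(3), of "neg v"]] pl_cancel_le[OF assms(1,2)] assms(4)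
  by (metis leq_trans)

lemma le_of_nonneg_diff:
  assumes "nonneg (neg x \<oplus> y)"
  shows "x \<sqsubseteq> y"
proof -
  define A B C D where "A = pl x" and "B = pl (neg x)" and "C = pl y" and "D = pl (neg y)"
  note defs = A_def B_def C_def D_def
  have nn: "nonneg A" "nonneg B" "nonneg C" "nonneg D"
    by (simp_all add: defs)
  have mi: "mi x = neg B" "mi y = neg D"
    by (simp_all add: defs neg_pl)
  have "neg x \<oplus> y = (B \<oplus> C) \<oplus> (neg A \<oplus> neg D)"
    using add_decomp[of "neg x" y] by (simp add: defs neg_pl)
  then have "nonneg (neg (A \<oplus> D) \<oplus> (B \<oplus> C))"
    using assms by (simp add: neg_add add_commute)
  then have le: "A \<oplus> D \<sqsubseteq> B \<oplus> C"
    using nn by (simp add: le_of_nonneg_diff_nonneg nonneg_add)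
  have "A \<sqsubseteq> A \<oplus> D" "D \<sqsubseteq> A \<oplus> D"
    using le_add_left[OF zero_le_nonneg[OF nn(4)], of A] le_add_left[OF zero_le_nonneg[OF nn(1)], of D]
    by (simp_all add: nonneg_add_zero zero_add_nonneg nn add_commute[of D])
  then have "A \<sqsubseteq> B \<oplus> C" "D \<sqsubseteq> C \<oplus> B"
    using le leq_trans by (simp_all add: add_commute[of C B])
  \<comment> \<open>\<open>A - B\<close> is \<open>zero \<oplus> x\<close>, whose positive part is
    \<open>A\<close>; \<open>D - C\<close> is treated alike with \<open>neg y\<close>.\<close>
  moreover have "pl (neg B \<oplus> A) = A"
    using pl_add_mi[of x] by (simp add: defs neg_pl add_commute[of "mi x"] pl_zero_add)
  moreover have "pl (neg C \<oplus> D) = D"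
    using pl_add_mi[of "neg y"] by (simp add: defs neg_pl add_commute[of "mi (neg y)"] pl_zero_add)
  ultimately have AC: "A \<sqsubseteq> C" and DB: "D \<sqsubseteq> B"
    using nn le_of_disjoint by blast+
  \<comment> \<open>The two halves of \<open>join_eq\<close>: the maximum of \<open>A\<close> and
    \<open>C\<close> is \<open>C\<close>, that of \<open>-B\<close> and \<open>-D\<close> is
    \<open>-D\<close>.\<close>
  have "A \<oplus> pl (neg A \<oplus> C) = C"
    using AC nn by (metis join_nonneg leq_def zero_add_nonneg)
  moreover have "neg B \<oplus> pl (B \<oplus> neg D) = neg D"
  proof -
    have "pl (B \<oplus> neg D) = B \<oplus> neg D"
      using nonneg_diff_of_le[OF DB] by (simp add: nonneg_def add_commute)
    \<comment> \<open>Cancellation is checked on both parts: the positive part is \<open>D\<close>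
      and the negative part is 0.\<close>
    moreover have "B \<oplus> (neg B \<oplus> D) = D"
    proof -
      have "pl (B \<oplus> (neg B \<oplus> D)) = D"
        using nn by (simp add: pl_cancel_nonneg) (simp add: nonneg_def)
      moreover have "mi (B \<oplus> (neg B \<oplus> D)) = zero"
        using mi_cancel[of "neg B" D] nn by (simp add: mi_nonneg)
          (metis add_commute add_neg)
      ultimately show ?thesis
        using pl_add_mi[of "B \<oplus> (neg B \<oplus> D)"] nn(4)
        by (simp add: nonneg_add_zero)
    qed
    ultimately show ?thesis
      by (metis neg_add neg_neg)
  qed
  ultimately have "join x y = C \<oplus> neg D"
    by (simp add: join_eq mi A_def[symmetric] C_def[symmetric])
  then show ?thesis
    using pl_add_mi[of y] by (simp add: leq_def mi C_def)
qed

section \<open>Implication as order, and soundness of axioms and rules\<close>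

lemma nonneg_imp_iff: "nonneg (imp x y) \<longleftrightarrow> x \<sqsubseteq> y"
  using le_of_nonneg_diff nonneg_diff_of_le by (auto simp: imp_eq_add)

lemma neg_le_neg: "x \<sqsubseteq> y \<Longrightarrow> neg y \<sqsubseteq> neg x"
  by (metis contrapos nonneg_imp_iff)

lemma leq_refl: "x \<sqsubseteq> x"
  by (simp add: imp_self flip: nonneg_imp_iff)

lemma imp_mono:
  assumes "p \<sqsubseteq> q" "r \<sqsubseteq> t"
  shows "imp q r \<sqsubseteq> imp p t"
proof -
  have "neg q \<oplus> r \<sqsubseteq> neg q \<oplus> t"
    using assms(2) by (rule le_add_left)
  also have "neg q \<oplus> t \<sqsubseteq> neg p \<oplus> t"
    using le_add_left[OF neg_le_neg[OF assms(1)], of t] by (simp add: add_commute[of t])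
  finally show ?thesis
    by (simp add: imp_eq_add)
qed

lemma le_one: "x \<sqsubseteq> one"
  by (metis nonneg_imp_iff imp_eq_add add_commute nonneg_one_add)

lemma nonneg_self_imp_iff: "nonneg (imp (imp r r) x) \<longleftrightarrow> zero \<sqsubseteq> x"
  by (simp add: imp_self nonneg_imp_iff)

lemma designated_iff_nonneg: "designated imp one d \<longleftrightarrow> nonneg d"
  unfolding designated_def nonneg_def by (metis pl_eq_imp pl_pl)

lemma eval_fplus: "eval imp neg one e (fplus p) = pl (eval imp neg one e p)"
  by (simp add: fplus_def pl_eq_imp)

lemma eval_fminus: "eval imp neg one e (fminus p) = mi (eval imp neg one e p)"
  by (simp add: fminus_def mi_eq_imp)

lemma eval_fjoin: "eval imp neg one e (fjoin p q) = join (eval imp neg one e p) (eval imp neg one e q)"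
  by (simp add: fjoin_def ajoin_def eval_fplus eval_fminus)

lemma zero_imp_le: "x \<sqsubseteq> imp zero x" "imp zero x \<sqsubseteq> x"
  using leq_refl[of x] by (simp_all add: leq_def imp_eq_add join_zero_add_left join_zero_add_right)

lemma axiom_nonneg:
  assumes "axiom p"
  shows "nonneg (eval imp neg one e p)"
proof -
  note eval_simps = nonneg_imp_iff eval_fplus eval_fminus eval_fjoin
  \<comment> \<open>Except for Q3 and Q10, every axiom evaluates to an implication between equal
    elements.\<close>
  have le_eq: "x \<sqsubseteq> y" if "x = y" for x y
    using that leq_refl by simp
  from assms show ?thesis
  proof cases
    case Q1a then show ?thesis by (simp only: eval.simps eval_simps) (rule le_eq, rule contrapos)
  next
    case Q1b then show ?thesis by (simp only: eval.simps eval_simps) (rule le_eq, rule contrapos[symmetric])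
  next
    case Q2a then show ?thesis by (simp add: eval_simps imp_one_absorb leq_refl)
  next
    case Q2b then show ?thesis by (simp add: eval_simps imp_one_absorb leq_refl)
  next
    case Q3a then show ?thesis by (simp add: eval_simps imp_self zero_imp_le)
  next
    case Q3b then show ?thesis by (simp add: eval_simps imp_self zero_imp_le)
  next
    case Q4a then show ?thesis by (simp only: eval.simps eval_simps) (rule le_eq, rule imp_decomp)
  next
    case Q4b then show ?thesis by (simp only: eval.simps eval_simps) (rule le_eq, rule imp_decomp[symmetric])
  next
    case Q5a then show ?thesis by (simp add: eval_simps neg_imp leq_refl)
  next
    case Q5b then show ?thesis by (simp add: eval_simps neg_imp leq_refl)
  next
    case Q6a then show ?thesis by (simp add: eval_simps pl_imp leq_refl)
  next
    case Q6b then show ?thesis by (simp add: eval_simps pl_imp leq_refl)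
  next
    case Q7a then show ?thesis by (simp only: eval.simps eval_simps) (rule le_eq, metis imp_join join_commute)
  next
    case Q7b then show ?thesis by (simp only: eval.simps eval_simps) (rule le_eq, metis imp_join join_commute)
  next
    case Q8a then show ?thesis by (simp add: eval_simps join_assoc leq_refl)
  next
    case Q8b then show ?thesis by (simp add: eval_simps join_assoc leq_refl)
  next
    case Q9 then show ?thesis by (simp only: eval.simps eval_simps) (rule le_eq, rule one_exchange)
  next
    case Q10 then show ?thesis by (simp add: eval_simps le_one)
  qed
qed

text \<open>For the rule Flat: a nonnegative -1 puts 1, hence every element, below 0. Nonnegativity
  of \<open>d\<close> makes \<open>neg d\<close> absorb the summand 0.\<close>

lemma nonneg_neg_of_nonneg_neg_one:
  assumes "nonneg d" "nonneg (neg one)"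
  shows "nonneg (neg d)"
proof -
  have "one \<sqsubseteq> zero"
    using neg_le_neg[OF zero_le_nonneg[OF assms(2)]] by simp
  then have "nonneg (neg d \<oplus> zero)"
    using le_one leq_trans nonneg_diff_of_le by blast
  moreover have "neg d \<oplus> zero = neg d"
    using zero_add_nonneg[OF assms(1)] by (metis add_commute neg_add neg_zero)
  ultimately show ?thesis by simp
qed

lemma deriv_nonneg:
  assumes "deriv H q" "\<forall>p\<in>set H. nonneg (eval imp neg one e p)"
  shows "nonneg (eval imp neg one e q)"
  using assms(1)
proof induction
  case (ax p)
  then show ?case by (rule axiom_nonneg)
next
  case (hyp p)
  then show ?case using assms(2) by blast
next
  case (qMP r p q)
  then show ?case
    by (simp add: nonneg_self_imp_iff self_imp_unit) (metis leq_trans nonneg_imp_iff)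
next
  case (Reg p r)
  then show ?case by (simp add: nonneg_self_imp_iff zero_le_nonneg)
next
  \<comment> \<open>AReg1 to AReg3 hold because implications, their negations and -1 absorb a
    summand 0.\<close>
  case (AReg1 r p q)
  then show ?case by (simp add: self_imp_unit)
next
  case (AReg2 r p q)
  then show ?case by (simp add: self_imp_unit neg_imp)
next
  case (AReg3 r)
  then show ?case by (simp add: imp_self) (metis imp_eq_add neg_add neg_zero zero_add_one)
next
  case (AReg4 r)
  then show ?case by (simp add: nonneg_def)
next
  case (Inv1 p)
  then show ?case by simp
next
  case (Inv2 p)
  then show ?case by simp
next
  case (Flat p)
  then show ?case using nonneg_neg_of_nonneg_neg_one by simp
next
  case (R2' p q r t)
  then show ?case by (simp add: nonneg_imp_iff imp_mono)
next
  case (R3' r p)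
  then have "pl (eval imp neg one e p) = zero \<oplus> eval imp neg one e p"
    by (simp add: nonneg_self_imp_iff zero_le_iff)
  then have "mi (eval imp neg one e p) = zero"
    by (metis mi_zero_add mi_pl)
  then show ?case by (simp add: eval_fminus)
qed

end

theorem theorem4p2:
  fixes H :: "'v fm list" and q :: "'v fm"
  assumes "deriv H q"
  shows "sem_conseq TYPE('a) H q"
  unfolding sem_conseq_def
proof (intro allI impI)
  fix imp :: "'a \<Rightarrow> 'a \<Rightarrow> 'a" and neg pl mi one and e :: "'v \<Rightarrow> 'a"
  assume "sqW_star imp neg pl mi one"
    and hyps: "\<forall>p\<in>set H. designated imp one (eval imp neg one e p)"
  then interpret sqW_star_algebra imp neg pl mi one
    by unfold_locales
  show "designated imp one (eval imp neg one e q)"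
    using deriv_nonneg[OF assms] hyps by (simp add: designated_iff_nonneg)
qed

end
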